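(* There exists $\epsilon_0>0$ such that for all $0<\epsilon\le\epsilon_0$, all integers $K\ge5$ and $n\ge1$, and every probability vector $\boldsymbol p=(p_1,\dots,p_K)$, there exists a block code $(f,\varphi)$, $$f:\mathcal X^n\to\{0,1\}^{\lceil n(H+\epsilon)\rceil},\qquad\varphi:\{0,1\}^{\lceil n(H+\epsilon)\rceil}\to\mathcal X^n,$$ with probability of error satisfying $$e(f,\varphi)\le\exp\left(-\frac{n\epsilon^2}{4(\log_2K)^2}\right).$$
   Context: $X$ is a discrete random variable with values in a finite alphabet $\mathcal X=\{x_1,\dots,x_K\}$ (of size $K$) with $\mathbb P(X=x_k)=p_k$. $H=-\sum_{k=1}^Kp_k\log_2p_k$ with $0\log_2 0=0$. $\boldsymbol X^n=(X_1,\dots,X_n)$ consists of i.i.d. copies of $X$. An $n$-to-$m$ binary block code is a pair of maps $f:\mathcal X^n\to\{0,1\}^m$ (coder) and $\varphi:\{0,1\}^m\to\mathcal X^n$ (decoder). Its probability of error is $e(f,\varphi)=\mathbb P(\varphi(f(\boldsymbol X^n))\ne\boldsymbol X^n)$. $\lceil\cdot\rceil$ is rounding up to the next integer and $\log_2$ is the base-2 logarithm. *)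

theory Defs
  imports "HOL-Probability.Probability"
begin

definition prob_vector :: "nat \<Rightarrow> (nat \<Rightarrow> real) \<Rightarrow> bool" where
  "prob_vector K p \<longleftrightarrow> (\<forall>k\<in>{1..K}. 0 \<le> p k) \<and> (\<Sum>k=1..K. p k) = 1"

text \<open>Terms with \<^term>\<open>p k = 0\<close> vanish because of the factor \<^term>\<open>p k\<close>, so the convention
  for \<open>0 log 0\<close> is built in.\<close>

definition shannon_entropy :: "nat \<Rightarrow> (nat \<Rightarrow> real) \<Rightarrow> real" where
  "shannon_entropy K p = - (\<Sum>k=1..K. p k * log 2 (p k))"

definition words :: "'a set \<Rightarrow> nat \<Rightarrow> 'a list set" where
  "words A n = {w. set w \<subseteq> A \<and> length w = n}"

text \<open>Bit strings of length \<open>m\<close> are the words of length \<open>m\<close> over \<^typ>\<open>bool\<close>. The values of the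
  coder outside \<open>words A n\<close>, and of the decoder on bit strings of the wrong length, are irrelevant.\<close>

definition block_code ::
    "'a set \<Rightarrow> nat \<Rightarrow> nat \<Rightarrow> ('a list \<Rightarrow> bool list) \<Rightarrow> (bool list \<Rightarrow> 'a list) \<Rightarrow> bool" where
  "block_code A n m f \<phi> \<longleftrightarrow> f \<in> words A n \<rightarrow> words UNIV m \<and> \<phi> \<in> words UNIV m \<rightarrow> words A n"

text \<open>\<open>replicate_pmf n P\<close> is the law of a list of \<open>n\<close> independent letters, each with law \<open>P\<close>.\<close>

definition error_prob ::
    "'a pmf \<Rightarrow> nat \<Rightarrow> ('a list \<Rightarrow> bool list) \<Rightarrow> (bool list \<Rightarrow> 'a list) \<Rightarrow> real" where
  "error_prob P n f \<phi> = measure_pmf.prob (replicate_pmf n P) {w. \<phi> (f w) \<noteq> w}"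

end

theory Submission
  imports Defs
begin

text \<open>
  The code is injective on the words of probability greater than \<open>2 powr (- n (H + \<epsilon>))\<close>, of which
  there are at most \<open>2 powr (n (H + \<epsilon>))\<close>. By Chernoff's bound, the error probability is at most
  \<open>(exp (- s \<delta>) E (exp (s (U - \<mu>))))\<^sup>n\<close>, where \<open>U = - ln p(X)\<close> has mean \<open>\<mu>\<close> and \<open>\<delta> = \<epsilon> ln 2\<close>. With
  \<open>l = ln K\<close>, the second moment of \<open>U\<close> is at most \<open>7/4 l\<^sup>2\<close>, and the remainder of third order in \<open>s\<close>
  fits into the missing \<open>l\<^sup>2 / 4\<close> as soon as \<open>s l\<^sup>2\<close> is smaller than an absolute constant. Hence
  \<open>E (exp (s (U - \<mu>))) \<le> exp (s\<^sup>2 l\<^sup>2)\<close>, and \<open>s = \<delta> / (2 l\<^sup>2)\<close> gives the exponent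
  \<open>- n \<delta>\<^sup>2 / (4 l\<^sup>2) = - n \<epsilon>\<^sup>2 / (4 (log 2 K)\<^sup>2)\<close>.
\<close>

section \<open>Words and their probabilities\<close>

lemma words_Suc: "words A (Suc n) = (\<lambda>(a, w). a # w) ` (A \<times> words A n)"
  by (auto simp: words_def length_Suc_conv image_iff)

lemma finite_words: "finite A \<Longrightarrow> finite (words A n)"
  unfolding words_def by (rule finite_lists_length_eq)

lemma card_words: "finite A \<Longrightarrow> card (words A n) = card A ^ n"
  unfolding words_def by (rule card_lists_length_eq)

lemma sum_words_prod_list:
  fixes g :: "'a \<Rightarrow> 'b::comm_semiring_1"
  shows "(\<Sum>w\<in>words A n. prod_list (map g w)) = (\<Sum>a\<in>A. g a) ^ n"
proof (induction n)
  case 0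
  have "words A 0 = {[]}" by (auto simp: words_def)
  then show ?case by simp
next
  case (Suc n)
  have "inj_on (\<lambda>(a, w). a # w) (A \<times> words A n)" by (auto simp: inj_on_def)
  then have "(\<Sum>w\<in>words A (Suc n). prod_list (map g w))
      = (\<Sum>(a, w)\<in>A \<times> words A n. g a * prod_list (map g w))"
    unfolding words_Suc by (subst sum.reindex) (auto simp: case_prod_unfold)
  also have "\<dots> = (\<Sum>a\<in>A. g a) * (\<Sum>w\<in>words A n. prod_list (map g w))"
    by (simp add: sum_product sum.cartesian_product)
  finally show ?case using Suc.IH by simp
qed

lemma pmf_replicate_pmf:
  "length w = n \<Longrightarrow> pmf (replicate_pmf n P) w = prod_list (map (pmf P) w)"
proof (induction n arbitrary: w)
  case (Suc n)
  then obtain a v where w: "w = a # v" and v: "length v = n" by (auto simp: length_Suc_conv)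
  have "replicate_pmf (Suc n) P = map_pmf (\<lambda>(a, v). a # v) (pair_pmf P (replicate_pmf n P))"
    by (simp add: pair_pmf_def map_pmf_def bind_assoc_pmf bind_return_pmf)
  moreover have "inj (\<lambda>(a :: 'a, v). a # v)" by (auto simp: inj_on_def)
  ultimately have "pmf (replicate_pmf (Suc n) P) w = pmf (pair_pmf P (replicate_pmf n P)) (a, v)"
    using pmf_map_inj'[of "\<lambda>(a, v). a # v" "pair_pmf P (replicate_pmf n P)" "(a, v)"] w by simp
  then show ?case using Suc.IH[OF v] w by (simp add: pmf_pair)
qed simp

section \<open>Coding a set of typical words\<close>

text \<open>An injection of \<open>S\<close> into the bit strings serves as coder and its inverse as
  decoder. Everything else goes to a constant default word, which exists as \<open>A\<close> is
  nonempty.\<close>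

lemma exists_block_code:
  assumes "finite A" "A \<noteq> {}" "S \<subseteq> words A n" "card S \<le> 2 ^ m"
  obtains f \<phi> where "block_code A n m f \<phi>" "\<And>w. w \<in> S \<Longrightarrow> \<phi> (f w) = w"
proof -
  let ?B = "words (UNIV :: bool set) m"
  have fS: "finite S" using assms finite_words finite_subset by metis
  have cB: "card ?B = 2 ^ m" by (simp add: card_words card_UNIV_bool)
  obtain h where h: "h ` S \<subseteq> ?B" "inj_on h S"
    using card_le_inj[OF fS, of ?B] finite_words[of "UNIV :: bool set" m] assms(4) cB by auto
  have "replicate m True \<in> ?B" by (auto simp: words_def)
  moreover obtain a where "a \<in> A" using assms(2) by auto
  then have "replicate n a \<in> words A n" by (auto simp: words_def)
  ultimately have
    "block_code A n m (\<lambda>w. if w \<in> S then h w else replicate m True)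
      (\<lambda>b. if b \<in> h ` S then inv_into S h b else replicate n a)"
    using h assms(3) unfolding block_code_def by (auto simp: image_subset_iff subset_iff)
  then show ?thesis by (rule that) (use h in auto)
qed

text \<open>Chernoff's argument: on \<open>E\<close> the factor
  \<open>exp (s * (- ln (prod_list (map (pmf P) w)) - real n * c))\<close> is at least 1. The
  weighted probabilities are products over letters, so their sum over all words is an
  \<open>n\<close>-th power.\<close>

lemma prob_le_exponential_moment:
  fixes P :: "'a pmf" and s :: real
  assumes A: "finite A" "set_pmf P \<subseteq> A" and s: "0 \<le> s"
    and E: "\<And>w. w \<in> words A n \<Longrightarrow> w \<in> E \<Longrightarrow> prod_list (map (pmf P) w) \<le> exp (- (real n * c))"
  shows "measure_pmf.prob (replicate_pmf n P) E
    \<le> (\<Sum>a\<in>A. pmf P a * exp (s * (- ln (pmf P a) - c))) ^ n"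
proof -
  let ?g = "\<lambda>a. pmf P a * exp (s * (- ln (pmf P a) - c))"
  have prod_g: "prod_list (map ?g w)
      = prod_list (map (pmf P) w) * exp (s * (- ln (prod_list (map (pmf P) w)) - real (length w) * c))"
    if "\<forall>a\<in>set w. pmf P a > 0" for w
    using that
  proof (induction w)
    case (Cons a w)
    have "prod_list (map (pmf P) w) > 0"
      using Cons.prems by (induction w) auto
    then show ?case using Cons
      by (simp add: ln_mult exp_add[symmetric] algebra_simps)
  qed simp
  have g0: "0 \<le> prod_list (map ?g w)" for w
    by (induction w) auto
  have bound: "pmf (replicate_pmf n P) w \<le> prod_list (map ?g w)" if "w \<in> words A n" "w \<in> E" for w
  proof (cases "\<forall>a\<in>set w. pmf P a > 0")
    case True
    then have pos: "prod_list (map (pmf P) w) > 0" by (induction w) auto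
    have "ln (prod_list (map (pmf P) w)) \<le> - (real n * c)"
      using E[OF that] pos by (metis ln_exp ln_le_cancel_iff exp_gt_zero)
    then have "1 \<le> exp (s * (- ln (prod_list (map (pmf P) w)) - real n * c))"
      using s by simp
    then show ?thesis
      using that(1) pos pmf_replicate_pmf[of w n P] prod_g[OF True] by (simp add: words_def)
  next
    \<comment> \<open>The convention \<open>ln 0 = 0\<close> breaks the product identity here, but
      the word then has probability zero and nonnegativity of the right-hand side suffices.\<close>
    case False
    then have "0 \<in> set (map (pmf P) w)"
      by (auto simp: image_iff) (metis less_eq_real_def pmf_nonneg)
    then have "prod_list (map (pmf P) w) = 0" by (simp add: prod_list_zero_iff)
    then show ?thesis using that(1) pmf_replicate_pmf[of w n P] g0[of w] by (simp add: words_def)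
  qed
  have "measure_pmf.prob (replicate_pmf n P) E = measure_pmf.prob (replicate_pmf n P) (E \<inter> words A n)"
    using A(2) by (intro measure_pmf.finite_measure_eq_AE)
      (auto simp: AE_measure_pmf_iff set_replicate_pmf words_def)
  also have "\<dots> = (\<Sum>w\<in>E \<inter> words A n. pmf (replicate_pmf n P) w)"
    using A(1) by (intro measure_measure_pmf_finite) (simp add: finite_words)
  also have "\<dots> \<le> (\<Sum>w\<in>E \<inter> words A n. prod_list (map ?g w))"
    by (intro sum_mono bound) auto
  also have "\<dots> \<le> (\<Sum>w\<in>words A n. prod_list (map ?g w))"
    using A(1) g0 by (intro sum_mono2) (auto simp: finite_words)
  finally show ?thesis by (simp add: sum_words_prod_list)
qed

text \<open>Each counted word has mass above \<open>exp (- b)\<close>, while the total mass is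
  1.\<close>

lemma card_typical_le:
  fixes P :: "'a pmf"
  assumes "finite A" "set_pmf P \<subseteq> A"
  shows "real (card {w \<in> words A n. exp (- b) < prod_list (map (pmf P) w)}) \<le> exp b"
proof -
  let ?S = "{w \<in> words A n. exp (- b) < prod_list (map (pmf P) w)}"
  have "real (card ?S) * exp (- b) \<le> (\<Sum>w\<in>?S. prod_list (map (pmf P) w))"
    by (intro sum_bounded_below) auto
  also have "\<dots> \<le> (\<Sum>w\<in>words A n. prod_list (map (pmf P) w))"
    using assms(1) by (intro sum_mono2) (auto simp: finite_words intro!: prod_list_nonneg)
  also have "\<dots> = 1"
    using assms by (simp add: sum_words_prod_list sum_pmf_eq_1)
  finally show ?thesis by (simp add: exp_minus field_simps)
qed

section \<open>The moment generating function of the information content\<close>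

lemma square_le_exp:
  fixes x :: real
  assumes "0 \<le> x"
  shows "x\<^sup>2 \<le> exp x"
proof -
  have "x / 2 \<le> exp (x / 2 - 1)" using exp_ge_add_one_self[of "x / 2 - 1"] by linarith
  then have "x / 2 * exp 1 \<le> exp (x / 2)" unfolding exp_diff by (simp add: pos_le_divide_eq)
  moreover have "2 \<le> exp (1::real)" using exp_ge_add_one_self[of 1] by simp
  ultimately have "x \<le> exp (x / 2)"
    using assms mult_left_mono[of 2 "exp 1" "x / 2"] by linarith
  then have "x\<^sup>2 \<le> (exp (x / 2))\<^sup>2" using assms by (intro power_mono)
  then show ?thesis by (simp add: exp_double[symmetric])
qed

lemma cube_le_exp:
  fixes x :: real
  assumes "0 \<le> x"
  shows "x ^ 3 \<le> 6 * exp x"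
proof -
  obtain t where "exp x = (\<Sum>m<4. x ^ m / fact m) + exp t / fact 4 * x ^ 4"
    using Maclaurin_exp_le[of x 4] by auto
  moreover have "0 \<le> exp t / fact 4 * x ^ 4" by simp
  moreover have "(\<Sum>m<4. x ^ m / fact m) = 1 + x + x\<^sup>2 / 2 + x ^ 3 / 6"
    by (simp add: numeral_eq_Suc fact_numeral)
  ultimately have "1 + x + x\<^sup>2 / 2 + x ^ 3 / 6 \<le> exp x" by linarith
  moreover have "0 \<le> x\<^sup>2" by simp
  ultimately show ?thesis using assms by argo
qed

text \<open>Taylor expansion with Lagrange remainder. The separate majorant \<open>y\<close> lets
  the remainder be bounded later by a quantity free of the mean \<open>\<mu>\<close>.\<close>

lemma exp_le_cubic_remainder:
  fixes x y :: real
  assumes "\<bar>x\<bar> \<le> y"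
  shows "exp x \<le> 1 + x + x\<^sup>2 / 2 + y ^ 3 * exp y / 6"
proof -
  obtain t where t: "\<bar>t\<bar> \<le> \<bar>x\<bar>" "exp x = (\<Sum>m<3. x ^ m / fact m) + exp t / fact 3 * x ^ 3"
    using Maclaurin_exp_le[of x 3] by auto
  have "exp t * x ^ 3 \<le> exp y * y ^ 3"
  proof -
    have "x ^ 3 \<le> \<bar>x\<bar> ^ 3" by (metis abs_ge_self power_abs)
    also have "\<dots> \<le> y ^ 3" using assms by (intro power_mono) auto
    finally have "exp t * x ^ 3 \<le> exp t * y ^ 3" by simp
    also have "\<dots> \<le> exp y * y ^ 3" using t assms by (intro mult_right_mono) auto
    finally show ?thesis .
  qed
  then show ?thesis using t(2) by (simp add: numeral_eq_Suc fact_numeral mult.commute)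
qed

text \<open>Meant for \<open>t = p * K\<close>, the density relative to the uniform law;
  \<open>t * ln t - t + 1\<close> is the nonnegative integrand of the relative entropy. For
  \<open>t > 1\<close>, one factor \<open>ln t\<close> is replaced by \<open>l\<close>, and
  \<open>2 * t - t * ln t\<close> is at most e, hence at most \<open>3\<close>;
  \<open>l \<ge> 4 / 3\<close> makes \<open>3 \<le> 2 + 3 / 4 * l\<close>.\<close>

lemma mult_ln_square_le:
  fixes t l :: real
  assumes t: "0 < t" "ln t \<le> l" and l: "4 / 3 \<le> l"
  shows "t * (ln t)\<^sup>2 \<le> 2 * l * (t * ln t - t + 1) + 3 / 4 * l\<^sup>2"
proof (cases "t \<le> 1")
  case True
  have "1 - 1 / t \<le> ln t" using ln_le_minus_one[of "1 / t"] t by (simp add: ln_div)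
  then have "t * (1 - 1 / t) \<le> t * ln t" using t by (intro mult_left_mono) auto
  then have "0 \<le> t * ln t - t + 1" using t by (simp add: algebra_simps)
  then have "0 \<le> 2 * l * (t * ln t - t + 1)" using l by (intro mult_nonneg_nonneg) auto
  moreover have "t * (ln t)\<^sup>2 \<le> 1"
  proof -
    have "(- ln t)\<^sup>2 \<le> exp (- ln t)" using True t by (intro square_le_exp) auto
    then show ?thesis using t by (simp add: exp_minus field_simps)
  qed
  moreover have "(4 / 3)\<^sup>2 \<le> l\<^sup>2" using l by (intro power_mono) auto
  then have "1 \<le> 3 / 4 * l\<^sup>2" by (simp add: power2_eq_square)
  ultimately show ?thesis by linarith
next
  case False
  have "t * ln t * ln t \<le> t * ln t * l" using False t by (intro mult_left_mono) auto
  moreover have "2 * t - t * ln t \<le> 3"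
  proof -
    have "ln (exp 1 / t) \<le> exp 1 / t - 1" using t by (intro ln_le_minus_one) auto
    then have "t * (2 - ln t) \<le> t * (exp 1 / t)"
      using t by (intro mult_left_mono) (auto simp: ln_div)
    then show ?thesis using t exp_le by (simp add: algebra_simps)
  qed
  then have "l * (2 * t - t * ln t) \<le> l * (2 + 3 / 4 * l)" using l by (intro mult_left_mono) auto
  ultimately show ?thesis by (simp add: algebra_simps power2_eq_square)
qed

text \<open>The bounds of the next three lemmas are affine in \<open>p\<close>: summed over an alphabet of size \<open>K\<close>, the
  terms \<open>1 / K - p\<close> cancel.\<close>

lemma entropy_term_le:
  fixes p K :: real
  assumes "0 \<le> p" "0 < K"
  shows "p * - ln p \<le> ln K * p + (1 / K - p)"
proof (cases "p = 0")
  case False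
  then have "ln (1 / (p * K)) \<le> 1 / (p * K) - 1" using assms by (intro ln_le_minus_one) auto
  then have "p * (- ln p - ln K) \<le> p * (1 / (p * K) - 1)"
    using assms False by (intro mult_left_mono) (auto simp: ln_div ln_mult)
  then show ?thesis using assms False by (simp add: algebra_simps)
qed (use assms in auto)

lemma information_square_term_le:
  fixes p K :: real
  assumes p: "0 \<le> p" "p \<le> 1" and K: "4 / 3 \<le> ln K" "0 < K"
  shows "p * (ln p)\<^sup>2 \<le> (ln K)\<^sup>2 * p + 2 * ln K * (1 / K - p) + 3 / 4 * (ln K)\<^sup>2 * (1 / K)"
proof (cases "p = 0")
  case False
  then have t: "0 < p * K" "ln (p * K) \<le> ln K" using p K by (auto simp: ln_mult)
  \<comment> \<open>With \<open>t = p * K\<close>, the factor \<open>2 * ln K\<close> on the right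
    is exactly what cancels the cross term in \<open>p * ln p\<close>, leaving a bound affine in
    \<open>p\<close>.\<close>
  have "p * K * (ln p + ln K)\<^sup>2
      \<le> 2 * ln K * (p * K * (ln p + ln K) - p * K + 1) + 3 / 4 * (ln K)\<^sup>2"
    using mult_ln_square_le[OF t K(1)] False p K by (simp add: ln_mult)
  then have "K * (p * (ln p)\<^sup>2)
      \<le> K * ((ln K)\<^sup>2 * p + 2 * ln K * (1 / K - p) + 3 / 4 * (ln K)\<^sup>2 * (1 / K))"
    using K by (simp add: power2_eq_square algebra_simps)
  then show ?thesis using K by simp
next
  case True
  have "1 \<le> K" using K by (intro ln_ge_zero_imp_ge_one) linarith+
  then show ?thesis using True by simp
qed

lemma cubic_remainder_term_le:
  fixes p K s :: real
  assumes p: "0 \<le> p" "p \<le> 1" and K: "1 \<le> ln K" "0 < K" and s: "0 \<le> s" "6 * s * ln K \<le> 1"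
  shows "p * ((ln K - ln p) ^ 3 * exp (s * (ln K - ln p))) \<le> 81 * ln K ^ 3 * p + 1296 * (1 / K)"
proof (cases "p = 0")
  case p0: False
  define l where "l = ln K"
  define u where "u = - ln p"
  have u0: "0 \<le> u" using p p0 by (simp add: u_def)
  have l: "1 \<le> l" using K by (simp add: l_def)
  have sl: "6 * (s * l) \<le> 1" using s by (simp add: l_def)
  have s6: "6 * s \<le> 1" using sl l s mult_left_mono[of 1 l s] by simp
  have pu: "p = exp (- u)" using p p0 by (simp add: u_def)
  have "p * ((l + u) ^ 3 * exp (s * (l + u))) \<le> 81 * l ^ 3 * p + 1296 * (1 / K)"
  \<comment> \<open>Up to \<open>2 * l\<close> the exponent is at most 1 and the cube at most
    \<open>(3 * l) ^ 3\<close>. Beyond it, cube and exponential each cost a multiple of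
    \<open>exp (u / 4)\<close>, and the remaining \<open>exp (- u / 2)\<close> is below
    \<open>exp (- l) = 1 / K\<close>.\<close>
  proof (cases "u \<le> 2 * l")
    case True
    have "exp (s * (l + u)) \<le> exp 1"
      using s sl mult_left_mono[OF True, of s] by (simp add: algebra_simps)
    then have "exp (s * (l + u)) \<le> 3" using exp_le by linarith
    moreover have "(l + u) ^ 3 \<le> (3 * l) ^ 3" using True u0 l by (intro power_mono) auto
    ultimately have "(l + u) ^ 3 * exp (s * (l + u)) \<le> (3 * l) ^ 3 * 3"
      using l u0 by (intro mult_mono) auto
    then have "p * ((l + u) ^ 3 * exp (s * (l + u))) \<le> p * ((3 * l) ^ 3 * 3)"
      using p by (intro mult_left_mono) auto
    also have "\<dots> = 81 * l ^ 3 * p" by (simp add: power_mult_distrib)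
    moreover have "0 \<le> 1296 * (1 / K)" using K by simp
    ultimately show ?thesis by linarith
  next
    case False
    have lu: "l + u \<le> 3 / 2 * u" using False by simp
    have "s * (l + u) \<le> 1 / 4 * u"
      using mult_left_mono[OF lu, of s] mult_right_mono[OF s6 u0] s by simp
    then have e: "exp (s * (l + u)) \<le> exp (u / 4)" by simp
    have "(u / 4) ^ 3 \<le> 6 * exp (u / 4)" using u0 by (intro cube_le_exp) auto
    \<comment> \<open>Here \<open>3 / 2 * u = 6 * (u / 4)\<close>, so the constant is
      \<open>6 ^ 3 * 6 = 1296\<close>.\<close>
    then have u3: "(3 / 2 * u) ^ 3 \<le> 1296 * exp (u / 4)"
      by (simp add: power_mult_distrib power_divide)
    have "(l + u) ^ 3 \<le> (3 / 2 * u) ^ 3" using lu u0 l by (intro power_mono) auto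
    with u3 have "(l + u) ^ 3 \<le> 1296 * exp (u / 4)" by linarith
    then have "(l + u) ^ 3 * exp (s * (l + u)) \<le> 1296 * exp (u / 4) * exp (u / 4)"
      using e l u0 by (intro mult_mono) auto
    then have "p * ((l + u) ^ 3 * exp (s * (l + u))) \<le> p * (1296 * exp (u / 4) * exp (u / 4))"
      using p by (intro mult_left_mono) auto
    also have "\<dots> = 1296 * exp (- u / 2)"
      unfolding pu by (simp add: exp_add[symmetric])
    also have "\<dots> \<le> 1296 * exp (- l)" using False by simp
    also have "\<dots> = 1296 * (1 / K)" using K by (simp add: l_def exp_minus inverse_eq_divide)
    moreover have "0 \<le> 81 * l ^ 3 * p" using l p by simp
    ultimately show ?thesis by linarith
  qed
  then show ?thesis by (simp add: l_def u_def)
qed (use K in auto)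

text \<open>Expansion around the mean kills the linear term. The quadratic term contributes at most
  \<open>7 / 8 * s\<^sup>2 * l\<^sup>2\<close>, and the condition on \<open>s\<close> keeps the
  cubic term within the remaining eighth.\<close>

lemma information_mgf_le:
  fixes p :: "'a \<Rightarrow> real"
  assumes A: "finite A" "4 \<le> card A" and p: "\<And>a. a \<in> A \<Longrightarrow> 0 \<le> p a" "sum p A = 1"
  defines "l \<equiv> ln (real (card A))" and "\<mu> \<equiv> (\<Sum>a\<in>A. p a * - ln (p a))"
  assumes s: "0 \<le> s" "1000 * s * l\<^sup>2 \<le> 1"
  shows "(\<Sum>a\<in>A. p a * exp (s * (- ln (p a) - \<mu>))) \<le> exp (s\<^sup>2 * l\<^sup>2)"
proof -
  let ?K = "real (card A)"
  have K: "0 < ?K" using A by simp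
  \<comment> \<open>Four letters suffice for \<open>l \<ge> 4 / 3\<close>, since
    \<open>ln 2 \<ge> 2 / 3\<close>.\<close>
  have "ln (2 ^ 2) \<le> l" unfolding l_def using A by (intro ln_mono) auto
  moreover have "ln (2 ^ 2) = 2 * ln (2 :: real)" by (subst ln_realpow) auto
  ultimately have l: "4 / 3 \<le> l" using ln2_ge_two_thirds by linarith
  have p1: "p a \<le> 1" if "a \<in> A" for a
    using member_le_sum[OF that, of p] A p by simp
  have unif: "(\<Sum>a\<in>A. 1 / ?K) = 1" using K by simp
  have m0: "0 \<le> \<mu>" unfolding \<mu>_def using p p1
    by (intro sum_nonneg mult_nonneg_nonneg) (metis neg_0_le_iff_le less_eq_real_def ln_le_zero_iff ln_0)+
  have "\<mu> \<le> (\<Sum>a\<in>A. l * p a + (1 / ?K - p a))"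
    unfolding \<mu>_def l_def using p K by (intro sum_mono entropy_term_le) auto
  also have "\<dots> = l" using p(2) unif by (simp add: sum.distrib sum_subtractf sum_distrib_left[symmetric] del: sum_constant)
  finally have ml: "\<mu> \<le> l" .
  have "(\<Sum>a\<in>A. p a * (ln (p a))\<^sup>2)
      \<le> (\<Sum>a\<in>A. l\<^sup>2 * p a + 2 * l * (1 / ?K - p a) + 3 / 4 * l\<^sup>2 * (1 / ?K))"
    using p p1 l K unfolding l_def by (intro sum_mono information_square_term_le) auto
  also have "\<dots> = 7 / 4 * l\<^sup>2"
    by (simp only: sum.distrib sum_subtractf sum_distrib_left[symmetric] p(2) unif) simp
  finally have second: "(\<Sum>a\<in>A. p a * (ln (p a))\<^sup>2) \<le> 7 / 4 * l\<^sup>2" .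
  have var: "(\<Sum>a\<in>A. p a * (- ln (p a) - \<mu>)\<^sup>2) \<le> 7 / 4 * l\<^sup>2"
  proof -
    have "(\<Sum>a\<in>A. p a * (- ln (p a) - \<mu>)\<^sup>2)
        = (\<Sum>a\<in>A. p a * (ln (p a))\<^sup>2 - 2 * \<mu> * (p a * - ln (p a)) + \<mu>\<^sup>2 * p a)"
      by (intro sum.cong refl) (simp add: power2_eq_square algebra_simps)
    also have "\<dots> = (\<Sum>a\<in>A. p a * (ln (p a))\<^sup>2) - 2 * \<mu> * \<mu> + \<mu>\<^sup>2"
      by (simp only: sum.distrib sum_subtractf sum_distrib_left[symmetric] p(2) \<mu>_def[symmetric] mult_1_right)
    finally show ?thesis using second zero_le_square[of \<mu>] unfolding power2_eq_square by linarith
  qed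
  have "6 * s * l \<le> 1000 * s * l\<^sup>2"
    using mult_left_mono[of 1 l "6 * s * l"] mult_nonneg_nonneg[of s "l * l"] l s by (simp add: power2_eq_square algebra_simps)
  then have sl: "6 * s * l \<le> 1" using s by linarith
  let ?V = "\<lambda>a. l - ln (p a)"
  have "(\<Sum>a\<in>A. p a * (?V a ^ 3 * exp (s * ?V a))) \<le> (\<Sum>a\<in>A. 81 * l ^ 3 * p a + 1296 * (1 / ?K))"
    using p p1 l K s sl unfolding l_def by (intro sum_mono cubic_remainder_term_le) auto
  also have "\<dots> = 81 * l ^ 3 + 1296"
    by (simp only: sum.distrib sum_distrib_left[symmetric] p(2) unif)
  \<comment> \<open>The constant is \<open>6 * 1000 / 8\<close>: after division by \<open>6\<close>,
    \<open>1000 * s * l\<^sup>2 \<le> 1\<close> turns it into \<open>1 / 8\<close>.\<close>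
  also have "\<dots> \<le> 750 * l ^ 4"
  proof -
    have "l ^ 3 * (4 / 3) \<le> l ^ 3 * l" using l by (intro mult_left_mono) auto
    moreover have "(4 / 3) ^ 4 \<le> l ^ 4" using l by (intro power_mono) auto
    ultimately show ?thesis by (simp add: power_divide numeral_eq_Suc mult_ac)
  qed
  finally have third: "(\<Sum>a\<in>A. p a * (?V a ^ 3 * exp (s * ?V a))) \<le> 750 * l ^ 4" .
  have "p a * exp (s * (- ln (p a) - \<mu>))
      \<le> p a + s * (p a * - ln (p a) - \<mu> * p a) + s\<^sup>2 / 2 * (p a * (- ln (p a) - \<mu>)\<^sup>2)
        + s ^ 3 / 6 * (p a * (?V a ^ 3 * exp (s * ?V a)))" if a: "a \<in> A" for a
  proof (cases "p a = 0")
    case False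
    then have "0 < p a" using p(1)[OF a] by simp
    then have "0 \<le> - ln (p a)" using p1[OF a] by simp
    \<comment> \<open>Both \<open>- ln (p a)\<close> and \<open>\<mu>\<close> are nonnegative and
      \<open>\<mu> \<le> l\<close>, so the deviation is dominated by the sum of
      \<open>- ln (p a)\<close> and \<open>l\<close>.\<close>
    then have "\<bar>- ln (p a) - \<mu>\<bar> \<le> ?V a" using m0 ml by linarith
    then have "\<bar>s * (- ln (p a) - \<mu>)\<bar> \<le> s * ?V a"
      using s by (simp add: abs_mult mult_left_mono)
    from mult_left_mono[OF exp_le_cubic_remainder[OF this] p(1)[OF a]]
    show ?thesis unfolding power_mult_distrib by (simp add: algebra_simps)
  qed simp
  then have "(\<Sum>a\<in>A. p a * exp (s * (- ln (p a) - \<mu>)))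
      \<le> (\<Sum>a\<in>A. p a + s * (p a * - ln (p a) - \<mu> * p a) + s\<^sup>2 / 2 * (p a * (- ln (p a) - \<mu>)\<^sup>2)
        + s ^ 3 / 6 * (p a * (?V a ^ 3 * exp (s * ?V a))))"
    by (rule sum_mono)
  also have "\<dots> = 1 + s\<^sup>2 / 2 * (\<Sum>a\<in>A. p a * (- ln (p a) - \<mu>)\<^sup>2)
      + s ^ 3 / 6 * (\<Sum>a\<in>A. p a * (?V a ^ 3 * exp (s * ?V a)))"
    by (simp only: sum.distrib sum_subtractf sum_distrib_left[symmetric] p(2) \<mu>_def[symmetric]) simp
  also have "\<dots> \<le> 1 + s\<^sup>2 / 2 * (7 / 4 * l\<^sup>2) + s ^ 3 / 6 * (750 * l ^ 4)"
    using var third s by (intro add_mono mult_left_mono) auto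
  also have "\<dots> \<le> 1 + s\<^sup>2 * l\<^sup>2"
  proof -
    have "s\<^sup>2 * l\<^sup>2 * (1000 * s * l\<^sup>2) \<le> s\<^sup>2 * l\<^sup>2 * 1" using s(2) by (intro mult_left_mono) auto
    then show ?thesis by (simp add: numeral_eq_Suc algebra_simps)
  qed
  also have "\<dots> \<le> exp (s\<^sup>2 * l\<^sup>2)" by simp
  finally show ?thesis .
qed

section \<open>Choice of the parameters and the resulting error exponent\<close>

theorem proposition1:
  "\<exists>\<epsilon>\<^sub>0::real. \<epsilon>\<^sub>0 > 0 \<and>
    (\<forall>\<epsilon>::real. 0 < \<epsilon> \<and> \<epsilon> \<le> \<epsilon>\<^sub>0 \<longrightarrow>
      (\<forall>(K::nat) (n::nat) (p :: nat \<Rightarrow> real) (x :: nat \<Rightarrow> 'a) (P :: 'a pmf).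
        5 \<le> K \<and> 1 \<le> n \<and> prob_vector K p \<and> inj_on x {1..K} \<and>
        (\<forall>k\<in>{1..K}. pmf P (x k) = p k) \<longrightarrow>
        (\<exists>(f :: 'a list \<Rightarrow> bool list) (\<phi> :: bool list \<Rightarrow> 'a list).
          block_code (x ` {1..K}) n (nat \<lceil>real n * (shannon_entropy K p + \<epsilon>)\<rceil>) f \<phi> \<and>
          error_prob P n f \<phi> \<le> exp (- (real n * \<epsilon>\<^sup>2 / (4 * (log 2 (real K))\<^sup>2))))))"
proof (rule exI[of _ "1 / 1000"], intro conjI allI impI)
  fix \<epsilon> :: real and K n :: nat and p :: "nat \<Rightarrow> real" and x :: "nat \<Rightarrow> 'a" and P :: "'a pmf"
  assume eps: "0 < \<epsilon> \<and> \<epsilon> \<le> 1 / 1000"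
  assume "5 \<le> K \<and> 1 \<le> n \<and> prob_vector K p \<and> inj_on x {1..K} \<and> (\<forall>k\<in>{1..K}. pmf P (x k) = p k)"
  then have K: "5 \<le> K" and pv: "prob_vector K p" and inj: "inj_on x {1..K}"
    and P: "\<And>k. k \<in> {1..K} \<Longrightarrow> pmf P (x k) = p k"
    by auto
  define A where "A = x ` {1..K}"
  define \<mu> where "\<mu> = (\<Sum>a\<in>A. pmf P a * - ln (pmf P a))"
  define l where "l = ln (real K)"
  define \<delta> where "\<delta> = \<epsilon> * ln 2"
  \<comment> \<open>This \<open>s\<close> minimizes
    \<open>s\<^sup>2 * l\<^sup>2 - s * \<delta>\<close>. It gives
    \<open>1000 * s * l\<^sup>2 = 500 * \<delta>\<close>, so
    \<open>\<epsilon> \<le> 1 / 1000\<close> meets the smallness condition for every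
    \<open>K\<close>.\<close>
  define s where "s = \<delta> / (2 * l\<^sup>2)"
  define m where "m = nat \<lceil>real n * (shannon_entropy K p + \<epsilon>)\<rceil>"
  let ?c = "\<mu> + \<delta>"
  have A: "finite A" "A \<noteq> {}" "card A = K"
    using K inj by (auto simp: A_def card_image)
  have sumA: "(\<Sum>a\<in>A. g (pmf P a)) = (\<Sum>k=1..K. g (p k))" for g :: "real \<Rightarrow> real"
    unfolding A_def using inj P by (simp add: sum.reindex)
  have sum1: "sum (pmf P) A = 1" using sumA[of "\<lambda>y. y"] pv by (simp add: prob_vector_def)
  \<comment> \<open>The prescribed masses already sum to 1, so \<open>P\<close> puts no mass outside
    \<open>A\<close>.\<close>
  then have "measure_pmf.prob P A = 1" using A(1) by (simp add: measure_measure_pmf_finite)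
  then have set: "set_pmf P \<subseteq> A" by (auto simp: measure_pmf.prob_eq_1 AE_measure_pmf_iff)
  have mu: "\<mu> = shannon_entropy K p * ln 2"
    unfolding \<mu>_def sumA[of "\<lambda>y. y * - ln y"] shannon_entropy_def log_def
    by (simp add: sum_negf sum_divide_distrib[symmetric])
  have l: "0 < l" using K by (simp add: l_def)
  have delta: "0 < \<delta>" "\<delta> \<le> 1 / 1000"
    using eps ln_2_less_1 mult_mono[of \<epsilon> "1/1000" "ln 2" 1] by (auto simp: \<delta>_def)
  define S where "S = {w \<in> words A n. exp (- (real n * ?c)) < prod_list (map (pmf P) w)}"
  have "real (card S) \<le> exp (real n * ?c)" unfolding S_def by (rule card_typical_le[OF A(1) set])
  also have "\<dots> = 2 powr (real n * (shannon_entropy K p + \<epsilon>))"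
    by (simp add: powr_def mu \<delta>_def algebra_simps)
  also have "\<dots> \<le> 2 powr real m" unfolding m_def by (intro powr_mono) (auto intro: real_nat_ceiling_ge)
  also have "\<dots> = real (2 ^ m)" by (simp add: powr_realpow)
  finally have "card S \<le> 2 ^ m" by (simp only: of_nat_le_iff)
  then obtain f \<phi> where code: "block_code A n m f \<phi>" and dec: "\<And>w. w \<in> S \<Longrightarrow> \<phi> (f w) = w"
    using exists_block_code[OF A(1,2), of S n m] by (auto simp: S_def)
  have s: "0 \<le> s" "1000 * s * l\<^sup>2 \<le> 1" using delta l by (auto simp: s_def)
  have "error_prob P n f \<phi> \<le> (\<Sum>a\<in>A. pmf P a * exp (s * (- ln (pmf P a) - ?c))) ^ n"
    unfolding error_prob_def
  proof (rule prob_le_exponential_moment[OF A(1) set s(1)])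
    fix w assume "w \<in> words A n" "w \<in> {w. \<phi> (f w) \<noteq> w}"
    with dec[of w] show "prod_list (map (pmf P) w) \<le> exp (- (real n * ?c))"
      unfolding S_def by (auto intro: leI)
  qed
  also have "\<dots> \<le> exp (s\<^sup>2 * l\<^sup>2 - s * \<delta>) ^ n"
  proof (rule power_mono)
    have "(\<Sum>a\<in>A. pmf P a * exp (s * (- ln (pmf P a) - ?c)))
        = (\<Sum>a\<in>A. pmf P a * exp (s * (- ln (pmf P a) - \<mu>))) * exp (- (s * \<delta>))"
      unfolding sum_distrib_right
      by (intro sum.cong refl) (simp add: exp_add[symmetric] algebra_simps)
    also have "\<dots> \<le> exp (s\<^sup>2 * l\<^sup>2) * exp (- (s * \<delta>))"
      using information_mgf_le[of A "pmf P" s] A K sum1 s unfolding l_def \<mu>_def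
      by (intro mult_right_mono) auto
    finally show "(\<Sum>a\<in>A. pmf P a * exp (s * (- ln (pmf P a) - ?c))) \<le> exp (s\<^sup>2 * l\<^sup>2 - s * \<delta>)"
      by (simp add: exp_diff exp_minus divide_inverse)
  qed (auto intro: sum_nonneg)
  also have "\<dots> = exp (real n * (s\<^sup>2 * l\<^sup>2 - s * \<delta>))" by (simp add: exp_of_nat_mult)
  \<comment> \<open>The exponent depends on \<open>\<delta> / l\<close>, which equals
    \<open>\<epsilon> / log 2 K\<close>: the factors \<open>ln 2\<close> are absorbed in the change
    of base.\<close>
  also have "real n * (s\<^sup>2 * l\<^sup>2 - s * \<delta>) = - (real n * \<epsilon>\<^sup>2 / (4 * (log 2 (real K))\<^sup>2))"
    using l unfolding s_def \<delta>_def log_def l_def[symmetric]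
    by (simp add: power2_eq_square field_simps)
  finally show "\<exists>f \<phi>. block_code (x ` {1..K}) n (nat \<lceil>real n * (shannon_entropy K p + \<epsilon>)\<rceil>) f \<phi> \<and>
      error_prob P n f \<phi> \<le> exp (- (real n * \<epsilon>\<^sup>2 / (4 * (log 2 (real K))\<^sup>2)))"
    using code unfolding A_def m_def by blast
qed simp

end
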